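(* Let $X\sim\mathcal N(0,\sigma^2)$ with $\sigma>0$. Then, as $x\to+\infty$, $$I(x):=\mathbb E\big[\exp(-(ix+X)^4)\big]=\frac{4^{1/3}}{\sqrt3\,\sigma^{1/3}x^{1/3}}\,\exp(\Psi(x))\,\big(\cos(\Phi(x))+o(1)\big),$$ where $$\Psi(x):=\frac{1}{2\sigma^2}x^2-\frac{3}{2^{11/3}\sigma^{8/3}}x^{4/3}-\frac{1}{4^{5/3}\sigma^{10/3}}x^{2/3}+\frac{1}{24\sigma^4}$$ and $$\Phi(x):=-\frac{3\sqrt3}{2^{11/3}\sigma^{8/3}}x^{4/3}+\frac{\sqrt3}{4^{5/3}\sigma^{10/3}}x^{2/3}+\frac{\pi}{6}.$$
   Context: $i$ is the imaginary unit and $x$ is a positive real variable. *)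

theory Defs
  imports "HOL-Probability.Probability" "HOL-Library.Landau_Symbols"
begin

definition quartic_I :: "'a measure \<Rightarrow> ('a \<Rightarrow> real) \<Rightarrow> real \<Rightarrow> complex" where
  "quartic_I M X x =
     prob_space.expectation M
       (\<lambda>\<omega>. exp (- ((\<i> * complex_of_real x + complex_of_real (X \<omega>)) ^ 4)))"

definition quartic_Psi :: "real \<Rightarrow> real \<Rightarrow> real" where
  "quartic_Psi \<sigma> x =
     1 / (2 * \<sigma>\<^sup>2) * x\<^sup>2
     - 3 / (2 powr (11/3) * \<sigma> powr (8/3)) * x powr (4/3)
     - 1 / (4 powr (5/3) * \<sigma> powr (10/3)) * x powr (2/3)
     + 1 / (24 * \<sigma> ^ 4)"

definition quartic_Phi :: "real \<Rightarrow> real \<Rightarrow> real" where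
  "quartic_Phi \<sigma> x =
     - (3 * sqrt 3 / (2 powr (11/3) * \<sigma> powr (8/3)) * x powr (4/3))
     + sqrt 3 / (4 powr (5/3) * \<sigma> powr (10/3)) * x powr (2/3)
     + pi / 6"

end

theory Submission
  imports Defs "HOL-Complex_Analysis.Cauchy_Integral_Theorem"
begin

text \<open>
  The proof is the method of steepest descent, arranged so that all paths are straight lines.
  Put \<open>b = 1 / (2 \<sigma>\<^sup>2)\<close> and \<open>l = x / \<sigma>\<^sup>2\<close>.  Substituting \<open>z = i x + t\<close> in the Gaussian expectation turns
  \<open>I(x)\<close> into \<open>exp (b x\<^sup>2) / (\<sigma> sqrt (2 \<pi>))\<close> times the integral of the entire function
  \<open>exp (- z^4 - b z\<^sup>2 + i l z)\<close> over the line \<open>Im z = x\<close> (\<open>quartic_I_eq_line_integral\<close>).  The function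
  decays like a Gaussian on every horizontal strip, so the line may be moved to any height
  (\<open>quartic_weight_shift\<close>).

  The dominant phase \<open>- z^4 + i l z\<close> is critical where \<open>4 z^3 = i l\<close>.  Writing \<open>l = 32 y^3\<close>, two of the
  three solutions are \<open>y (sqrt 3 + i)\<close> and its mirror image \<open>y (- sqrt 3 + i)\<close>; both lie at height \<open>y\<close>,
  and along that line the real part of the phase is largest exactly at these two points.  The integrand takes
  conjugate values at mirror points, so the line integral is twice the real part of its right half
  (\<open>quartic_weight_fold\<close>).

  On the right half, \<open>z = y c + s / y\<close> with \<open>c = sqrt 3 + i\<close> makes the quadratic term
  \<open>- 6 c\<^sup>2 s\<^sup>2\<close> independent of \<open>y\<close>, and pulls out the explicit factor
  \<open>exp (- 24 y^4 - 2 b y\<^sup>2)\<close> together with the oscillating factor \<open>cis (24 sqrt 3 y^4 - 2 sqrt 3 b y\<^sup>2)\<close>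
  (\<open>half_line_integral_eq\<close>).  What remains converges pointwise to
  \<open>exp (- 6 c\<^sup>2 s\<^sup>2 - 2 b c s)\<close> and is dominated by \<open>exp (- 3 s\<^sup>2 + 4 b \<bar>s\<bar>)\<close> on the whole half line, so that
  dominated convergence alone gives the limit of the integral (\<open>saddle_integral_tendsto\<close>).  This limit is
  \<open>sqrt (\<pi> / 6) exp (b\<^sup>2 / 6) / c\<close>: completing the square produces the constant
  \<open>b\<^sup>2 / 6 = 1 / (24 \<sigma>^4)\<close> of \<open>\<Psi>\<close>, and the argument \<open>- \<pi> / 6\<close> of \<open>1 / c\<close> is the constant phase of \<open>\<Phi>\<close>.
\<close>

section \<open>Changing the line of integration\<close>

text \<open>
  Cauchy's theorem for two lines, without contours: an entire \<open>f\<close> has a primitive \<open>F\<close>, and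
  \<open>F (p + q s) - F (p' + q' s)\<close> is a primitive of the difference of the two integrands.  It tends to 0 at
  both ends since \<open>F\<close> varies little along the segment that joins the two lines.
\<close>

lemma entire_line_integral_eq:
  fixes f :: "complex \<Rightarrow> complex" and p q p' q' :: complex and B :: "real \<Rightarrow> real"
  assumes hol: "f holomorphic_on UNIV"
    and int: "integrable lborel (\<lambda>s::real. f (p + q * of_real s))"
    and int': "integrable lborel (\<lambda>s::real. f (p' + q' * of_real s))"
    and bound: "\<And>s z. z \<in> closed_segment (p' + q' * of_real s) (p + q * of_real s) \<Longrightarrow> norm (f z) \<le> B s"
    and top: "((\<lambda>s. B s * norm ((p + q * of_real s) - (p' + q' * of_real s))) \<longlongrightarrow> 0) at_top"
    and bot: "((\<lambda>s. B s * norm ((p + q * of_real s) - (p' + q' * of_real s))) \<longlongrightarrow> 0) at_bot"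
  shows "q * (LINT s|lborel. f (p + q * of_real s)) = q' * (LINT s|lborel. f (p' + q' * of_real s))"
proof -
  obtain F where F: "\<And>z. (F has_field_derivative f z) (at z)"
    using holomorphic_convex_primitive'[OF convex_UNIV open_UNIV hol] by auto
  define G where "G s = F (p + q * of_real s) - F (p' + q' * of_real s)" for s :: real
  define g where "g s = q * f (p + q * of_real s) - q' * f (p' + q' * of_real s)" for s :: real
  have contf: "continuous_on UNIV f"
    by (rule holomorphic_on_imp_continuous_on[OF hol])
  have deriv: "(G has_vector_derivative g s) (at s)" for s
  proof -
    have line: "((\<lambda>s::real. F (a + d * of_real s)) has_vector_derivative (d * f (a + d * of_real s))) (at s)"
      for a d
    proof -
      have "((\<lambda>s::real. a + d * of_real s) has_vector_derivative d) (at s)"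
        by (auto intro!: derivative_eq_intros)
      from field_vector_diff_chain_at[OF this F] show ?thesis by (simp add: o_def)
    qed
    show ?thesis
      unfolding G_def g_def by (intro has_vector_derivative_diff line)
  qed
  have contg: "isCont g s" for s
    unfolding g_def
    by (intro continuous_intros continuous_on_interior[OF continuous_on_compose2[OF contf, of UNIV]]) auto
  have intg: "integrable lborel g"
    unfolding g_def using int int' by simp
  have Gbound: "norm (G s) \<le> B s * norm ((p + q * of_real s) - (p' + q' * of_real s))" for s
    unfolding G_def
    by (rule field_differentiable_bound[where S = "closed_segment (p' + q' * of_real s) (p + q * of_real s)" and f' = f])
       (auto intro: has_field_derivative_at_within F bound)
  have "(LBINT s=-\<infinity>..\<infinity>. g s) = 0 - 0"
  proof (rule interval_integral_FTC_integrable)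
    show "((G \<circ> real_of_ereal) \<longlongrightarrow> 0) (at_right (-\<infinity>))"
      unfolding ereal_tendsto_simps1
      by (rule Lim_null_comparison[OF always_eventually bot]) (use Gbound in auto)
    show "((G \<circ> real_of_ereal) \<longlongrightarrow> 0) (at_left \<infinity>)"
      unfolding ereal_tendsto_simps1
      by (rule Lim_null_comparison[OF always_eventually top]) (use Gbound in auto)
    show "set_integrable lborel (einterval (-\<infinity>) \<infinity>) g"
      using intg by (simp add: set_integrable_def)
  qed (use deriv contg in auto)
  then have "(LINT s|lborel. g s) = 0"
    by (simp add: interval_lebesgue_integral_def set_lebesgue_integral_def)
  then show ?thesis
    unfolding g_def using int int' by simp
qed

section \<open>Gaussian integrals\<close>

lemma has_bochner_integral_gaussian:
  fixes a \<beta> :: real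
  assumes "a > 0"
  shows "has_bochner_integral lborel (\<lambda>t. exp (- a * t\<^sup>2 + \<beta> * t)) (sqrt (pi / a) * exp (\<beta>\<^sup>2 / (4 * a)))"
proof -
  define \<sigma> where "\<sigma> = sqrt (1 / (2 * a))"
  define \<mu> where "\<mu> = \<beta> / (2 * a)"
  have \<sigma>: "\<sigma> > 0" "\<sigma>\<^sup>2 = 1 / (2 * a)"
    using assms by (auto simp: \<sigma>_def)
  have "has_bochner_integral lborel (normal_density \<mu> \<sigma>) 1"
    using \<sigma>(1) by (simp add: has_bochner_integral_iff integrable_normal_density integral_normal_density)
  then have "has_bochner_integral lborel
      (\<lambda>t. sqrt (pi / a) * exp (\<beta>\<^sup>2 / (4 * a)) * normal_density \<mu> \<sigma> t) (sqrt (pi / a) * exp (\<beta>\<^sup>2 / (4 * a)) * 1)"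
    by (intro has_bochner_integral_mult_right) auto
  moreover have "sqrt (pi / a) * exp (\<beta>\<^sup>2 / (4 * a)) * normal_density \<mu> \<sigma> t = exp (- a * t\<^sup>2 + \<beta> * t)" for t
  proof -
    have "\<beta>\<^sup>2 / (4 * a) + - (t - \<mu>)\<^sup>2 / (2 * \<sigma>\<^sup>2) = - a * t\<^sup>2 + \<beta> * t"
      using assms unfolding \<sigma> \<mu>_def by (simp add: field_simps power2_eq_square)
    moreover have "sqrt (pi / a) / sqrt (2 * pi * \<sigma>\<^sup>2) = 1"
      using assms unfolding \<sigma> by simp
    moreover have "sqrt (pi / a) * exp (\<beta>\<^sup>2 / (4 * a)) * normal_density \<mu> \<sigma> t
        = sqrt (pi / a) / sqrt (2 * pi * \<sigma>\<^sup>2) * exp (\<beta>\<^sup>2 / (4 * a) + - (t - \<mu>)\<^sup>2 / (2 * \<sigma>\<^sup>2))"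
      unfolding normal_density_def exp_add by simp
    ultimately show ?thesis using assms by simp
  qed
  ultimately show ?thesis by simp
qed

lemma integrable_gaussian_abs:
  fixes a \<beta> :: real
  assumes "a > 0"
  shows "integrable lborel (\<lambda>t. exp (- a * t\<^sup>2 + \<beta> * \<bar>t\<bar>))"
proof (rule Bochner_Integration.integrable_bound)
  show "integrable lborel (\<lambda>t. exp (- a * t\<^sup>2 + \<beta> * t) + exp (- a * t\<^sup>2 + (-\<beta>) * t))"
    using has_bochner_integral_gaussian[OF assms] unfolding has_bochner_integral_iff
    by (intro Bochner_Integration.integrable_add) blast+
  have "exp (- a * t\<^sup>2 + \<beta> * \<bar>t\<bar>) \<le> exp (- a * t\<^sup>2 + \<beta> * t) + exp (- a * t\<^sup>2 + (-\<beta>) * t)" for t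
    by (cases "t \<ge> 0") (auto simp: add_increasing add_increasing2)
  then show "AE t in lborel. norm (exp (- a * t\<^sup>2 + \<beta> * \<bar>t\<bar>))
      \<le> norm (exp (- a * t\<^sup>2 + \<beta> * t) + exp (- a * t\<^sup>2 + (-\<beta>) * t))"
    by (simp add: add_nonneg_nonneg)
qed auto

text \<open>The right-hand saddle point at height \<open>y\<close> is \<open>y\<close> times this number, which is \<open>2 cis (\<pi> / 6)\<close>.\<close>

definition saddle_dir :: complex where
  "saddle_dir = Complex (sqrt 3) 1"

text \<open>
  The substitution \<open>z = c s\<close> would reduce this to a real Gaussian integral.  It amounts to rotating the
  line \<open>c \<real>\<close> back to \<open>\<real>\<close>, which is possible because \<open>Re (z\<^sup>2) \<ge> s\<^sup>2\<close> on the segment from \<open>s\<close> to \<open>c s\<close>.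
\<close>

lemma complex_gaussian_integral:
  fixes b :: real
  defines "c \<equiv> saddle_dir"
  assumes b: "b > 0"
  shows "(LINT s|lborel. exp (- 6 * c\<^sup>2 * (of_real s)\<^sup>2 - 2 * of_real b * c * of_real s))
         = of_real (sqrt (pi / 6) * exp (b\<^sup>2 / 6)) / c"
proof -
  define f where "f z = exp (- 6 * z\<^sup>2 - 2 * of_real b * z)" for z :: complex
  have sqrt3: "3/2 \<le> sqrt 3" "sqrt 3 \<le> 2"
    by (rule real_le_rsqrt, simp add: power2_eq_square) (rule real_le_lsqrt, auto)
  have c0: "c \<noteq> 0" by (simp add: c_def saddle_dir_def complex_eq_iff)
  have bound: "norm (f z) \<le> exp (- 6 * s\<^sup>2 + 4 * b * \<bar>s\<bar>)"
    if z: "z \<in> closed_segment (0 + 1 * of_real s) (0 + c * of_real s)" for s z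
  proof -
    from z obtain d where d: "0 \<le> d" "d \<le> 1" and zd: "z = (1 - d) *\<^sub>R of_real s + d *\<^sub>R (c * of_real s)"
      by (auto simp: closed_segment_def)
    define a where "a = (1 - d) + d * sqrt 3"
    have Rez: "Re z = a * s" and Imz: "Im z = d * s"
      by (auto simp: zd c_def saddle_dir_def a_def algebra_simps)
    have "a \<ge> 1 + d / 2"
      using mult_left_mono[OF sqrt3(1) d(1)] unfolding a_def by (simp add: algebra_simps)
    then have "a\<^sup>2 \<ge> (1 + d/2)\<^sup>2"
      using d by (intro power_mono) auto
    moreover have "d\<^sup>2 \<le> d" using d by (simp add: power2_eq_square mult_left_le)
    ultimately have "a\<^sup>2 - d\<^sup>2 \<ge> 1"
      using d zero_le_power2[of d] by (simp add: power2_eq_square algebra_simps)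
    then have sq: "(a\<^sup>2 - d\<^sup>2) * s\<^sup>2 \<ge> 1 * s\<^sup>2"
      by (intro mult_right_mono) auto
    have "a \<le> 2" "a \<ge> 0" using d mult_left_mono[OF sqrt3(2) d(1)] \<open>a \<ge> 1 + d / 2\<close> unfolding a_def by auto
    then have "- (a * s) \<le> 2 * \<bar>s\<bar>"
      by (metis abs_ge_minus_self abs_ge_zero abs_mult abs_of_nonneg mult_right_mono order_trans)
    from mult_left_mono[OF this, of "2*b"] have "- (2 * b * (a * s)) \<le> 4 * b * \<bar>s\<bar>"
      using b by simp
    moreover have "Re (- 6 * z\<^sup>2 - 2 * of_real b * z) = - 6 * ((a\<^sup>2 - d\<^sup>2) * s\<^sup>2) - 2 * b * (a * s)"
      by (simp add: Rez Imz power2_eq_square algebra_simps)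
    ultimately have "Re (- 6 * z\<^sup>2 - 2 * of_real b * z) \<le> - 6 * s\<^sup>2 + 4 * b * \<bar>s\<bar>"
      using sq by linarith
    then show ?thesis
      unfolding f_def norm_exp_eq_Re by simp
  qed
  have bounded_int: "integrable lborel (\<lambda>s::real. f (0 + d * of_real s))" 
    if "\<And>s. norm (f (0 + d * of_real s)) \<le> exp (- 6 * s\<^sup>2 + 4 * b * \<bar>s\<bar>)" for d
  proof (rule Bochner_Integration.integrable_bound)
    show "integrable lborel (\<lambda>s. exp (- 6 * s\<^sup>2 + 4 * b * \<bar>s\<bar>))"
      using integrable_gaussian_abs[of 6 "4 * b"] by simp
    show "(\<lambda>s::real. f (0 + d * of_real s)) \<in> borel_measurable lborel"
      unfolding f_def by measurable
  qed (use that in auto)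
  have "c * (LINT s|lborel. f (0 + c * of_real s)) = 1 * (LINT s|lborel. f (0 + 1 * of_real s))"
  proof (rule entire_line_integral_eq[where B = "\<lambda>s. exp (- 6 * s\<^sup>2 + 4 * b * \<bar>s\<bar>)"])
    show "f holomorphic_on UNIV" unfolding f_def by (intro holomorphic_intros)
    have eq: "norm (0 + c * of_real s - (0 + 1 * complex_of_real s)) = norm (c - 1) * \<bar>s\<bar>" for s
      using norm_mult[of "c - 1" "of_real s"] by (simp add: algebra_simps)
    show "((\<lambda>s. exp (- 6 * s\<^sup>2 + 4 * b * \<bar>s\<bar>) * norm (0 + c * of_real s - (0 + 1 * complex_of_real s))) \<longlongrightarrow> 0) at_top"
      unfolding eq by real_asymp
    show "((\<lambda>s. exp (- 6 * s\<^sup>2 + 4 * b * \<bar>s\<bar>) * norm (0 + c * of_real s - (0 + 1 * complex_of_real s))) \<longlongrightarrow> 0) at_bot"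
      unfolding eq by real_asymp
    show "integrable lborel (\<lambda>s::real. f (0 + c * of_real s))" "integrable lborel (\<lambda>s::real. f (0 + 1 * of_real s))"
      by (intro bounded_int bound ends_in_segment)+
  qed (rule bound)
  also have "(LINT s|lborel. f (0 + 1 * of_real s)) = (LINT s|lborel. of_real (exp (- 6 * s\<^sup>2 + (- 2 * b) * s)))"
    by (simp add: f_def exp_of_real[symmetric])
  also have "\<dots> = of_real (sqrt (pi / 6) * exp ((- 2 * b)\<^sup>2 / (4 * 6)))"
    using has_bochner_integral_gaussian[of 6 "- 2 * b"]
    unfolding integral_complex_of_real has_bochner_integral_iff by simp
  finally show ?thesis
    using c0 by (simp add: f_def field_simps power_mult_distrib)
qed

section \<open>The entire integrand on horizontal lines\<close>

definition quartic_weight :: "real \<Rightarrow> real \<Rightarrow> complex \<Rightarrow> complex" where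
  "quartic_weight b l z = exp (- (z ^ 4) - of_real b * z\<^sup>2 + \<i> * of_real l * z)"

lemma holomorphic_quartic_weight: "quartic_weight b l holomorphic_on S"
  unfolding quartic_weight_def by (intro holomorphic_intros)

lemma measurable_quartic_weight [measurable]: "quartic_weight b l \<in> borel_measurable borel"
  by (intro borel_measurable_continuous_onI holomorphic_on_imp_continuous_on holomorphic_quartic_weight)

text \<open>
  On a strip \<open>\<bar>Im z\<bar> \<le> V\<close> the real part of \<open>- z^4\<close> is at most \<open>- u^4 + 6 V\<^sup>2 u\<^sup>2\<close> with \<open>u = Re z\<close>; completing the
  square bounds this by a constant minus \<open>u\<^sup>2\<close>.  The bound is far from sharp, but it suffices for
  integrability and for shifting lines.
\<close>

lemma norm_quartic_weight_le:
  assumes "b \<ge> 0" and "\<bar>Im z\<bar> \<le> V"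
  shows "norm (quartic_weight b l z) \<le> exp ((6 * V\<^sup>2 + 1)\<^sup>2 / 4 + b * V\<^sup>2 + \<bar>l\<bar> * V - (Re z)\<^sup>2)"
proof -
  obtain u v where z: "z = Complex u v" by (cases z)
  have "v\<^sup>2 \<le> V\<^sup>2" using assms(2) z by (simp add: abs_le_square_iff[symmetric])
  then have "6 * u\<^sup>2 * v\<^sup>2 \<le> 6 * u\<^sup>2 * V\<^sup>2" and bv: "b * v\<^sup>2 \<le> b * V\<^sup>2"
    using assms(1) by (auto intro: mult_left_mono)
  moreover have "0 \<le> (u\<^sup>2 - (6 * V\<^sup>2 + 1) / 2)\<^sup>2" by simp
  moreover have "\<bar>l * v\<bar> \<le> \<bar>l\<bar> * V"
    using assms(2) z by (simp add: abs_mult mult_left_mono)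
  moreover have "0 \<le> b * u\<^sup>2" "0 \<le> v ^ 4" using assms(1) by auto
  moreover have "Re (- (z ^ 4) - of_real b * z\<^sup>2 + \<i> * of_real l * z)
      = - (u ^ 4) + 6 * u\<^sup>2 * v\<^sup>2 - v ^ 4 - b * u\<^sup>2 + b * v\<^sup>2 - l * v"
    unfolding z by (simp add: power2_eq_square power4_eq_xxxx algebra_simps)
  moreover have "(u\<^sup>2 - (6 * V\<^sup>2 + 1) / 2)\<^sup>2 = u ^ 4 - 6 * u\<^sup>2 * V\<^sup>2 - u\<^sup>2 + (6 * V\<^sup>2 + 1)\<^sup>2 / 4"
    by (simp add: power2_eq_square power4_eq_xxxx field_simps)
  ultimately have "Re (- (z ^ 4) - of_real b * z\<^sup>2 + \<i> * of_real l * z)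
      \<le> (6 * V\<^sup>2 + 1)\<^sup>2 / 4 + b * V\<^sup>2 + \<bar>l\<bar> * V - u\<^sup>2"
    by linarith
  then show ?thesis
    unfolding quartic_weight_def norm_exp_eq_Re by (simp add: z)
qed

lemma integrable_quartic_weight_line:
  assumes "b \<ge> 0"
  shows "integrable lborel (\<lambda>s. quartic_weight b l (\<i> * of_real v + of_real s))"
proof (rule Bochner_Integration.integrable_bound)
  let ?K = "(6 * \<bar>v\<bar>\<^sup>2 + 1)\<^sup>2 / 4 + b * \<bar>v\<bar>\<^sup>2 + \<bar>l\<bar> * \<bar>v\<bar>"
  show "integrable lborel (\<lambda>s. exp ?K * exp (- 1 * s\<^sup>2 + 0 * \<bar>s\<bar>))"
    by (intro integrable_mult_right integrable_gaussian_abs) simp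
  show "AE s in lborel. norm (quartic_weight b l (\<i> * of_real v + of_real s))
      \<le> norm (exp ?K * exp (- 1 * s\<^sup>2 + 0 * \<bar>s\<bar>))"
  proof (rule AE_I2)
    fix s
    show "norm (quartic_weight b l (\<i> * of_real v + of_real s)) \<le> norm (exp ?K * exp (- 1 * s\<^sup>2 + 0 * \<bar>s\<bar>))"
      using norm_quartic_weight_le[OF assms, of "\<i> * of_real v + of_real s" "\<bar>v\<bar>" l]
      by (simp add: exp_add[symmetric] algebra_simps)
  qed
qed measurable

lemma quartic_weight_shift:
  assumes "b \<ge> 0"
  shows "(LINT s|lborel. quartic_weight b l (\<i> * of_real v + of_real s))
       = (LINT s|lborel. quartic_weight b l (\<i> * of_real v' + of_real s))"
proof -
  define V where "V = max \<bar>v\<bar> \<bar>v'\<bar>"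
  define K where "K = (6 * V\<^sup>2 + 1)\<^sup>2 / 4 + b * V\<^sup>2 + \<bar>l\<bar> * V"
  have diff: "norm (\<i> * of_real v + 1 * complex_of_real s - (\<i> * of_real v' + 1 * of_real s)) = \<bar>v - v'\<bar>" for s
    using norm_mult[of \<i> "of_real (v - v')"] norm_of_real[of "v - v'", where ?'a = complex]
    by (simp add: algebra_simps)
  have "1 * (LINT s|lborel. quartic_weight b l (\<i> * of_real v + 1 * of_real s))
       = 1 * (LINT s|lborel. quartic_weight b l (\<i> * of_real v' + 1 * of_real s))"
  proof (rule entire_line_integral_eq[where B = "\<lambda>s. exp (K - s\<^sup>2)"])
    show "norm (quartic_weight b l z) \<le> exp (K - s\<^sup>2)"
      if z: "z \<in> closed_segment (\<i> * of_real v' + 1 * of_real s) (\<i> * of_real v + 1 * of_real s)" for s z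
    proof -
      from z obtain d where d: "0 \<le> d" "d \<le> 1"
        and zd: "z = (1 - d) *\<^sub>R (\<i> * of_real v' + 1 * of_real s) + d *\<^sub>R (\<i> * of_real v + 1 * of_real s)"
        by (auto simp: closed_segment_def)
      have "\<bar>Im z\<bar> \<le> (1 - d) * V + d * V"
        using d unfolding zd V_def
        by (auto intro!: order_trans[OF abs_triangle_ineq] add_mono simp: abs_mult mult_left_mono)
      moreover have "Re z = s" by (simp add: zd algebra_simps)
      ultimately show ?thesis
        using norm_quartic_weight_le[OF assms, of z V l] by (simp add: K_def algebra_simps)
    qed
    show "((\<lambda>s. exp (K - s\<^sup>2) * norm (\<i> * of_real v + 1 * complex_of_real s - (\<i> * of_real v' + 1 * of_real s)))
        \<longlongrightarrow> 0) at_top"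
      unfolding diff by real_asymp
    show "((\<lambda>s. exp (K - s\<^sup>2) * norm (\<i> * of_real v + 1 * complex_of_real s - (\<i> * of_real v' + 1 * of_real s)))
        \<longlongrightarrow> 0) at_bot"
      unfolding diff by real_asymp
  qed (use integrable_quartic_weight_line[OF assms] holomorphic_quartic_weight in auto)
  then show ?thesis by simp
qed

lemma quartic_weight_cnj: "cnj (quartic_weight b l z) = quartic_weight b l (- cnj z)"
  unfolding quartic_weight_def exp_cnj by simp

text \<open>
  The weight takes conjugate values at the points \<open>u + i v\<close> and \<open>- u + i v\<close>.
\<close>

lemma quartic_weight_fold:
  assumes "b \<ge> 0"
  shows "(LINT s|lborel. quartic_weight b l (\<i> * of_real v + of_real s))
       = of_real (2 * Re (LINT s|lborel. indicator {0<..} s *\<^sub>R quartic_weight b l (\<i> * of_real v + of_real s)))"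
proof -
  define g where "g s = quartic_weight b l (\<i> * of_real v + of_real s)" for s :: real
  have int: "integrable lborel g"
    unfolding g_def by (rule integrable_quartic_weight_line[OF assms])
  have int': "integrable lborel (\<lambda>s. indicator A s *\<^sub>R g s)" if "A \<in> sets lborel" for A
    using int that by (intro integrable_mult_indicator) auto
  have refl: "g (- s) = cnj (g s)" for s
    by (simp add: g_def quartic_weight_cnj)
  have "(LINT s|lborel. g s) = (LINT s|lborel. indicator {0<..} s *\<^sub>R g s + indicator {..<0} s *\<^sub>R g s)"
  proof (rule integral_cong_AE)
    have "AE s in lborel. s \<noteq> (0::real)" by (rule AE_lborel_singleton)
    then show "AE s in lborel. g s = indicator {0<..} s *\<^sub>R g s + indicator {..<0} s *\<^sub>R g s"
      by eventually_elim (auto simp: indicator_def)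
  qed (use int int' in auto)
  also have "\<dots> = (LINT s|lborel. indicator {0<..} s *\<^sub>R g s) + (LINT s|lborel. indicator {..<0} s *\<^sub>R g s)"
    by (intro Bochner_Integration.integral_add int') auto
  also have "(LINT s|lborel. indicator {..<0} s *\<^sub>R g s) = (LINT s|lborel. cnj (indicator {0<..} s *\<^sub>R g s))"
    by (subst lborel_integral_real_affine[where c = "-1" and t = 0])
       (auto simp: refl indicator_def intro!: Bochner_Integration.integral_cong)
  finally show ?thesis
    unfolding Bochner_Integration.integral_cnj complex_add_cnj g_def .
qed

section \<open>The contribution of the right-hand saddle point\<close>

lemma saddle_dir_power2: "saddle_dir\<^sup>2 = Complex 2 (2 * sqrt 3)"
  and saddle_dir_power3: "saddle_dir ^ 3 = 8 * \<i>"
  by (simp_all add: saddle_dir_def power2_eq_square power3_eq_cube complex_eq_iff algebra_simps)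

lemma saddle_dir_power4: "saddle_dir ^ 4 = Complex (-8) (8 * sqrt 3)"
  using saddle_dir_power3 unfolding power_Suc[of _ 3, simplified, symmetric]
  by (simp add: numeral_eq_Suc saddle_dir_def complex_eq_iff)

text \<open>
  For \<open>l = 32 y^3\<close>, the weight on the right half of the line at height \<open>y\<close>, in the variable \<open>s\<close> with
  \<open>z = y * saddle_dir + s / y\<close> and divided by its value at \<open>s = 0\<close>.
\<close>

definition saddle_integrand :: "real \<Rightarrow> real \<Rightarrow> real \<Rightarrow> complex" where
  "saddle_integrand b y s = indicator {- sqrt 3 * y\<^sup>2<..} s *\<^sub>R
     exp (- 6 * saddle_dir\<^sup>2 * of_real (s\<^sup>2) - 4 * saddle_dir * of_real (s ^ 3 / y\<^sup>2) - of_real (s ^ 4 / y ^ 4)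
          - 2 * of_real b * saddle_dir * of_real s - of_real (b * s\<^sup>2 / y\<^sup>2))"

text \<open>
  Taylor expansion at the saddle point.  The coefficient \<open>32 y^3\<close> is chosen so that the terms
  linear in \<open>s\<close> from \<open>- z^4\<close> and from \<open>i l z\<close> cancel, by \<open>saddle_dir ^ 3 = 8 i\<close>; the remaining linear term
  comes from \<open>- b z\<^sup>2\<close> and stays of order 1.
\<close>

lemma quartic_weight_saddle_expansion:
  fixes y :: real
  assumes "y \<noteq> 0"
  shows "quartic_weight b (32 * y ^ 3) (of_real y * saddle_dir + of_real (s / y))
    = exp (of_real (- 24 * y ^ 4 - 2 * b * y\<^sup>2)) * cis (24 * sqrt 3 * y ^ 4 - 2 * sqrt 3 * b * y\<^sup>2)
      * exp (- 6 * saddle_dir\<^sup>2 * of_real (s\<^sup>2) - 4 * saddle_dir * of_real (s ^ 3 / y\<^sup>2) - of_real (s ^ 4 / y ^ 4)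
          - 2 * of_real b * saddle_dir * of_real s - of_real (b * s\<^sup>2 / y\<^sup>2))"
proof -
  define w :: complex where "w = of_real (s / y)"
  define Y :: complex where "Y = of_real y"
  define c where "c = saddle_dir"
  have c3: "c ^ 3 = 8 * \<i>" by (simp add: c_def saddle_dir_power3)
  (* The last summand is the linear term that vanishes by c3. *)
  have *: "- ((Y * c + w) ^ 4) - of_real b * (Y * c + w)\<^sup>2 + \<i> * (32 * Y ^ 3) * (Y * c + w)
     = - (Y ^ 4 * c ^ 4) - of_real b * Y\<^sup>2 * c\<^sup>2 + 32 * \<i> * Y ^ 4 * c
       + (- 6 * c\<^sup>2 * (Y * w)\<^sup>2 - 4 * c * (Y * w ^ 3) - w ^ 4 - 2 * of_real b * c * (Y * w) - of_real b * w\<^sup>2)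
       - 4 * (c ^ 3 - 8 * \<i>) * Y ^ 3 * w"
    by (simp add: power2_eq_square power3_eq_cube power4_eq_xxxx algebra_simps)
  have "of_real (s ^ 3 / y\<^sup>2) = Y * w ^ 3" "of_real (s\<^sup>2) = (Y * w)\<^sup>2" "of_real (s ^ 4 / y ^ 4) = w ^ 4"
    "of_real s = Y * w" "of_real (b * s\<^sup>2 / y\<^sup>2) = of_real b * w\<^sup>2"
    using assms unfolding w_def Y_def
    by (simp_all add: power2_eq_square power3_eq_cube power4_eq_xxxx)
  note subs = this
  (* The exponent at the saddle point; its real and imaginary parts give the modulus and the argument. *)
  have main: "- (Y ^ 4 * c ^ 4) - of_real b * Y\<^sup>2 * c\<^sup>2 + 32 * \<i> * Y ^ 4 * c
      = of_real (- 24 * y ^ 4 - 2 * b * y\<^sup>2) + \<i> * of_real (24 * sqrt 3 * y ^ 4 - 2 * sqrt 3 * b * y\<^sup>2)"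
    unfolding c_def Y_def saddle_dir_power2 saddle_dir_power4 of_real_power[symmetric]
    unfolding saddle_dir_def by (simp add: complex_eq_iff algebra_simps)
  show ?thesis
    unfolding quartic_weight_def cis_conv_exp exp_add[symmetric] main[symmetric] subs
    unfolding w_def[symmetric] Y_def[symmetric] c_def[symmetric]
    using * c3 by (simp add: Y_def)
qed

lemma half_line_integral_eq:
  fixes y :: real
  assumes "y > 0"
  shows "(LINT s|lborel. indicator {0<..} s *\<^sub>R quartic_weight b (32 * y ^ 3) (\<i> * of_real y + of_real s))
     = of_real (exp (- 24 * y ^ 4 - 2 * b * y\<^sup>2) / y) * cis (24 * sqrt 3 * y ^ 4 - 2 * sqrt 3 * b * y\<^sup>2)
       * (LINT s|lborel. saddle_integrand b y s)"
proof -
  have pt: "\<i> * of_real y + of_real (sqrt 3 * y + 1 / y * s) = of_real y * saddle_dir + of_real (s / y)" for s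
    by (simp add: saddle_dir_def complex_eq_iff)
  have ind: "indicator {0<..} (sqrt 3 * y + 1 / y * s) = (indicator {- sqrt 3 * y\<^sup>2<..} s :: real)" for s
    using assms by (simp add: indicator_def field_simps power2_eq_square)
  have "(LINT s|lborel. indicator {0<..} s *\<^sub>R quartic_weight b (32 * y ^ 3) (\<i> * of_real y + of_real s))
     = \<bar>1 / y\<bar> *\<^sub>R (LINT s|lborel. indicator {0<..} (sqrt 3 * y + 1 / y * s) *\<^sub>R
          quartic_weight b (32 * y ^ 3) (\<i> * of_real y + of_real (sqrt 3 * y + 1 / y * s)))"
    using assms by (subst lborel_integral_real_affine[where c = "1 / y" and t = "sqrt 3 * y"]) auto
  also have "\<dots> = \<bar>1 / y\<bar> *\<^sub>R (LINT s|lborel.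
      exp (of_real (- 24 * y ^ 4 - 2 * b * y\<^sup>2)) * cis (24 * sqrt 3 * y ^ 4 - 2 * sqrt 3 * b * y\<^sup>2)
      * saddle_integrand b y s)"
    unfolding pt ind using assms
    by (subst quartic_weight_saddle_expansion) (simp_all add: saddle_integrand_def)
  finally show ?thesis
    using assms by (simp add: scaleR_conv_of_real exp_of_real[symmetric])
qed

text \<open>
  With \<open>p = s / y\<^sup>2\<close> the real parts of the quadratic, cubic and quartic terms add up to \<open>- s\<^sup>2 (p + 2 sqrt 3)\<^sup>2\<close>.
  On the right half of the line \<open>p > - sqrt 3\<close>, so the square is at least 3.  The other
  saddle point sits at \<open>p = - 2 sqrt 3\<close>, which is why the line has to be cut in the middle.
\<close>

lemma norm_saddle_integrand_le:
  assumes "b > 0" and "y > 0"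
  shows "norm (saddle_integrand b y s) \<le> exp (- 3 * s\<^sup>2 + 4 * b * \<bar>s\<bar>)"
proof (cases "s > - sqrt 3 * y\<^sup>2")
  case True
  define p where "p = s / y\<^sup>2"
  have p: "s ^ 3 / y\<^sup>2 = s\<^sup>2 * p" "s ^ 4 / y ^ 4 = s\<^sup>2 * p\<^sup>2"
    using assms(2) by (simp_all add: p_def field_simps power2_eq_square power3_eq_cube power4_eq_xxxx)
  have "p \<ge> - sqrt 3"
    using True assms(2) by (simp add: p_def field_simps)
  then have "(sqrt 3)\<^sup>2 \<le> (p + 2 * sqrt 3)\<^sup>2"
    by (intro power_mono) auto
  then have "3 * s\<^sup>2 \<le> (p + 2 * sqrt 3)\<^sup>2 * s\<^sup>2"
    by (intro mult_right_mono) auto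
  moreover have "(p + 2 * sqrt 3)\<^sup>2 * s\<^sup>2 = 12 * s\<^sup>2 + 4 * sqrt 3 * (s\<^sup>2 * p) + s\<^sup>2 * p\<^sup>2"
    by (simp add: power2_eq_square algebra_simps)
  moreover have "- (2 * b * sqrt 3 * s) \<le> 4 * b * \<bar>s\<bar>"
  proof -
    have "sqrt 3 * (- s) \<le> sqrt 3 * \<bar>s\<bar>"
      by (intro mult_left_mono) auto
    also have "\<dots> \<le> 2 * \<bar>s\<bar>"
      by (intro mult_right_mono real_le_lsqrt) auto
    finally have "(2 * b) * (sqrt 3 * (- s)) \<le> (2 * b) * (2 * \<bar>s\<bar>)"
      using assms(1) by (intro mult_left_mono) auto
    then show ?thesis by (simp only: mult_minus_right mult.assoc[symmetric])
  qed
  moreover have "0 \<le> b * s\<^sup>2 / y\<^sup>2" using assms by simp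
  moreover have "Re (- 6 * saddle_dir\<^sup>2 * of_real (s\<^sup>2) - 4 * saddle_dir * of_real (s ^ 3 / y\<^sup>2) - of_real (s ^ 4 / y ^ 4)
          - 2 * of_real b * saddle_dir * of_real s - of_real (b * s\<^sup>2 / y\<^sup>2))
     = - 12 * s\<^sup>2 - 4 * sqrt 3 * (s\<^sup>2 * p) - s\<^sup>2 * p\<^sup>2 - 2 * b * sqrt 3 * s - b * s\<^sup>2 / y\<^sup>2"
    unfolding saddle_dir_power2 p by (simp add: saddle_dir_def)
  ultimately have "Re (- 6 * saddle_dir\<^sup>2 * of_real (s\<^sup>2) - 4 * saddle_dir * of_real (s ^ 3 / y\<^sup>2) - of_real (s ^ 4 / y ^ 4)
          - 2 * of_real b * saddle_dir * of_real s - of_real (b * s\<^sup>2 / y\<^sup>2)) \<le> - 3 * s\<^sup>2 + 4 * b * \<bar>s\<bar>"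
    by linarith
  then show ?thesis
    unfolding saddle_integrand_def using True by (simp add: norm_exp_eq_Re)
qed (simp add: saddle_integrand_def)

lemma saddle_integral_tendsto:
  assumes "b > 0"
  shows "((\<lambda>y. LINT s|lborel. saddle_integrand b y s) \<longlongrightarrow> of_real (sqrt (pi / 6) * exp (b\<^sup>2 / 6)) / saddle_dir) at_top"
proof -
  define L where "L s = exp (- 6 * saddle_dir\<^sup>2 * of_real (s\<^sup>2) - 2 * of_real b * saddle_dir * of_real s)" for s :: real
  have lim: "((\<lambda>y. saddle_integrand b y s) \<longlongrightarrow> L s) at_top" for s
  proof -
    let ?g = "\<lambda>y::real. exp (- 6 * saddle_dir\<^sup>2 * of_real (s\<^sup>2) - 4 * saddle_dir * of_real (s ^ 3 / y\<^sup>2) - of_real (s ^ 4 / y ^ 4)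
          - 2 * of_real b * saddle_dir * of_real s - of_real (b * s\<^sup>2 / y\<^sup>2))"
    have z: "((\<lambda>y. s ^ 3 / y\<^sup>2) \<longlongrightarrow> 0) at_top" "((\<lambda>y. s ^ 4 / y ^ 4) \<longlongrightarrow> 0) at_top"
      "((\<lambda>y. b * s\<^sup>2 / y\<^sup>2) \<longlongrightarrow> 0) at_top"
      by real_asymp+
    have "(?g \<longlongrightarrow> exp (- 6 * saddle_dir\<^sup>2 * of_real (s\<^sup>2) - 4 * saddle_dir * of_real 0 - of_real 0
          - 2 * of_real b * saddle_dir * of_real s - of_real 0)) at_top"
      by (intro tendsto_intros z)
    then have "(?g \<longlongrightarrow> L s) at_top" by (simp add: L_def)
    moreover have "eventually (\<lambda>y. ?g y = saddle_integrand b y s) at_top"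
    proof -
      have "filterlim (\<lambda>y::real. - sqrt 3 * y\<^sup>2) at_bot at_top" by real_asymp
      then have "eventually (\<lambda>y. - sqrt 3 * y\<^sup>2 < s) at_top"
        by (simp add: filterlim_at_bot_dense)
      then show ?thesis by eventually_elim (simp add: saddle_integrand_def)
    qed
    ultimately show ?thesis by (rule Lim_transform_eventually)
  qed
  have "((\<lambda>y. LINT s|lborel. saddle_integrand b y s) \<longlongrightarrow> (LINT s|lborel. L s)) at_top"
  proof (rule integral_dominated_convergence_at_top)
    show "integrable lborel (\<lambda>s. exp (- 3 * s\<^sup>2 + 4 * b * \<bar>s\<bar>))"
      using integrable_gaussian_abs[of 3 "4 * b"] by simp
    show "\<forall>\<^sub>F y in at_top. AE s in lborel. norm (saddle_integrand b y s) \<le> exp (- 3 * s\<^sup>2 + 4 * b * \<bar>s\<bar>)"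
      using eventually_gt_at_top[of 0]
      by eventually_elim (intro AE_I2 norm_saddle_integrand_le[OF assms])
    show "L \<in> borel_measurable lborel" unfolding L_def by measurable
    show "(\<lambda>s. saddle_integrand b y s) \<in> borel_measurable lborel" for y
      unfolding saddle_integrand_def by measurable
  qed (simp add: lim)
  also have "(LINT s|lborel. L s) = of_real (sqrt (pi / 6) * exp (b\<^sup>2 / 6)) / saddle_dir"
    using complex_gaussian_integral[OF assms] unfolding L_def by simp
  finally show ?thesis .
qed

section \<open>The asymptotic expansion\<close>

text \<open>
  With \<open>z = i x + t\<close>, the Gaussian exponent \<open>- t\<^sup>2 / (2 \<sigma>\<^sup>2)\<close> equals
  \<open>x\<^sup>2 / (2 \<sigma>\<^sup>2) - z\<^sup>2 / (2 \<sigma>\<^sup>2) + i (x / \<sigma>\<^sup>2) z\<close>.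
\<close>

lemma quartic_I_eq_line_integral:
  assumes "prob_space M" and \<sigma>: "\<sigma> > 0"
    and X: "distributed M lborel X (\<lambda>t. ennreal (normal_density 0 \<sigma> t))"
  shows "quartic_I M X x = of_real (exp (x\<^sup>2 / (2 * \<sigma>\<^sup>2)) / sqrt (2 * pi * \<sigma>\<^sup>2)) *
    (LINT t|lborel. quartic_weight (1 / (2 * \<sigma>\<^sup>2)) (x / \<sigma>\<^sup>2) (\<i> * of_real x + of_real t))"
proof -
  have meas: "X \<in> measurable M lborel" using X by (rule distributed_measurable)
  define g where "g t = exp (- ((\<i> * of_real x + of_real t) ^ 4))" for t :: real
  have [measurable]: "g \<in> borel_measurable borel"
    unfolding g_def by measurable
  have "quartic_I M X x = (LINT t|distr M lborel X. g t)"
    unfolding quartic_I_def g_def[symmetric] using meas by (subst integral_distr) auto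
  also have "\<dots> = (LINT t|density lborel (\<lambda>t. ennreal (normal_density 0 \<sigma> t)). g t)"
    using distributed_distr_eq_density[OF X] by simp
  also have "\<dots> = (LINT t|lborel. normal_density 0 \<sigma> t *\<^sub>R g t)"
    by (subst integral_density) auto
  also have "\<dots> = (LINT t|lborel. of_real (exp (x\<^sup>2 / (2 * \<sigma>\<^sup>2)) / sqrt (2 * pi * \<sigma>\<^sup>2)) *
      quartic_weight (1 / (2 * \<sigma>\<^sup>2)) (x / \<sigma>\<^sup>2) (\<i> * of_real x + of_real t))"
  proof (rule Bochner_Integration.integral_cong[OF refl])
    fix t
    have e: "of_real (- (t\<^sup>2 / (2 * \<sigma>\<^sup>2))) = of_real (x\<^sup>2 / (2 * \<sigma>\<^sup>2))
        - of_real (1 / (2 * \<sigma>\<^sup>2)) * (\<i> * of_real x + of_real t)\<^sup>2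
        + \<i> * of_real (x / \<sigma>\<^sup>2) * (\<i> * of_real x + complex_of_real t)"
      using \<sigma> by (simp add: complex_eq_iff power2_eq_square field_simps)
    have "normal_density 0 \<sigma> t *\<^sub>R g t
        = of_real (1 / sqrt (2 * pi * \<sigma>\<^sup>2)) * (exp (of_real (- (t\<^sup>2 / (2 * \<sigma>\<^sup>2)))) * g t)"
      by (simp add: normal_density_def scaleR_conv_of_real exp_of_real[symmetric])
    also have "exp (of_real (- (t\<^sup>2 / (2 * \<sigma>\<^sup>2)))) * g t = exp (of_real (x\<^sup>2 / (2 * \<sigma>\<^sup>2))) *
       quartic_weight (1 / (2 * \<sigma>\<^sup>2)) (x / \<sigma>\<^sup>2) (\<i> * of_real x + of_real t)"
      unfolding e g_def quartic_weight_def exp_add[symmetric] by (simp add: algebra_simps)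
    finally show "normal_density 0 \<sigma> t *\<^sub>R g t = of_real (exp (x\<^sup>2 / (2 * \<sigma>\<^sup>2)) / sqrt (2 * pi * \<sigma>\<^sup>2)) *
       quartic_weight (1 / (2 * \<sigma>\<^sup>2)) (x / \<sigma>\<^sup>2) (\<i> * of_real x + of_real t)"
      by (simp add: exp_of_real[symmetric])
  qed
  finally show ?thesis by simp
qed


text \<open>
  The height at which \<open>32 y^3 = x / \<sigma>\<^sup>2\<close>, and the combinations of it that make up \<open>\<Psi>\<close>, \<open>\<Phi>\<close> and the
  algebraic prefactor.
\<close>

lemma quartic_saddle_height_powers:
  fixes x \<sigma> :: real
  assumes x: "x > 0" and \<sigma>: "\<sigma> > 0"
  defines "y \<equiv> (x / (4 * \<sigma>\<^sup>2)) powr (1/3) / 2"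
  shows "32 * y ^ 3 = x / \<sigma>\<^sup>2"
    and "24 * y ^ 4 = 3 / (2 powr (11/3) * \<sigma> powr (8/3)) * x powr (4/3)"
    and "y\<^sup>2 / \<sigma>\<^sup>2 = 1 / (4 powr (5/3) * \<sigma> powr (10/3)) * x powr (2/3)"
    and "1 / (2 * \<sigma> * y) = 4 powr (1/3) / (\<sigma> powr (1/3) * x powr (1/3))"
proof -
  have four: "4 powr a = (2::real) powr (2 * a)" for a
    using powr_powr[of 2 2 a] by simp
  have "(\<sigma>\<^sup>2) powr a = \<sigma> powr (2 * a)" for a
    using powr_powr[of \<sigma> 2 a] \<sigma> by simp
  then have ypow: "y ^ n = x powr (real n / 3) / (2 powr (2 * (real n / 3)) * \<sigma> powr (2 * (real n / 3))) / 2 ^ n" for n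
    using x \<sigma> unfolding y_def power_divide
    by (subst powr_power) (simp_all add: powr_divide powr_mult four)
  have \<sigma>pow: "\<sigma> powr (a + 2) = \<sigma> powr a * \<sigma>\<^sup>2" "\<sigma> powr (a + 1) = \<sigma> powr a * \<sigma>" for a
    using \<sigma> by (simp_all add: powr_add)
  have twopow: "(2::real) powr (a + 1) = 2 powr a * 2" "(2::real) powr (a + 2) = 2 powr a * 4" for a
    by (simp_all add: powr_add)
  show "32 * y ^ 3 = x / \<sigma>\<^sup>2"
    using x \<sigma> by (simp add: ypow)
  show "24 * y ^ 4 = 3 / (2 powr (11/3) * \<sigma> powr (8/3)) * x powr (4/3)"
    using twopow(1)[of "8/3"] by (simp add: ypow)
  show "y\<^sup>2 / \<sigma>\<^sup>2 = 1 / (4 powr (5/3) * \<sigma> powr (10/3)) * x powr (2/3)"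
    using twopow(2)[of "4/3"] \<sigma>pow(1)[of "4/3"] \<sigma> by (simp add: ypow four)
  have "\<sigma> powr (1/3) * \<sigma> powr (2/3) = \<sigma>"
    using \<sigma> by (simp add: powr_add[symmetric])
  then have ratio: "\<sigma> powr (2/3) / \<sigma> = 1 / \<sigma> powr (1/3)"
    using \<sigma> by (simp add: field_simps)
  have y1: "y = x powr (1/3) / (2 powr (2/3) * \<sigma> powr (2/3)) / 2"
    using ypow[of 1] by simp
  have "1 / (2 * \<sigma> * y) = 4 powr (1/3) * (\<sigma> powr (2/3) / \<sigma>) / x powr (1/3)"
    unfolding y1 by (simp add: four)
  then show "1 / (2 * \<sigma> * y) = 4 powr (1/3) / (\<sigma> powr (1/3) * x powr (1/3))"
    unfolding ratio by simp
qed

lemma gaussian_prefactor: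
  fixes \<sigma> :: real
  assumes "\<sigma> > 0"
  shows "sqrt (pi / 6) / sqrt (2 * pi * \<sigma>\<^sup>2) = 1 / (2 * sqrt 3 * \<sigma>)"
proof -
  have "sqrt (pi / 6) / sqrt (2 * pi * \<sigma>\<^sup>2) = sqrt (1 / (3 * (2 * \<sigma>)\<^sup>2))"
    unfolding real_sqrt_divide[symmetric] using assms by (simp add: field_simps power_mult_distrib)
  also have "\<dots> = 1 / (2 * sqrt 3 * \<sigma>)"
    unfolding real_sqrt_divide real_sqrt_mult real_sqrt_abs using assms by simp
  finally show ?thesis .
qed

theorem theorem4p8:
  fixes M :: "'a measure" and X :: "'a \<Rightarrow> real" and \<sigma> :: real
  assumes "prob_space M"
    and "\<sigma> > 0"
    and "distributed M lborel X (\<lambda>t. ennreal (normal_density 0 \<sigma> t))"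
  shows "\<exists>r :: real \<Rightarrow> real. r \<in> o[at_top](\<lambda>_. 1) \<and>
    (\<forall>x>0. quartic_I M X x = complex_of_real
       (4 powr (1/3) / (sqrt 3 * \<sigma> powr (1/3) * x powr (1/3))
        * exp (quartic_Psi \<sigma> x) * (cos (quartic_Phi \<sigma> x) + r x)))"
proof -
  note \<sigma> = \<open>\<sigma> > 0\<close>
  define b where "b = 1 / (2 * \<sigma>\<^sup>2)"
  have b: "b > 0" using \<sigma> by (simp add: b_def)
  define y where "y x = (x / (4 * \<sigma>\<^sup>2)) powr (1/3) / 2" for x :: real
  define \<theta> where "\<theta> x = 24 * sqrt 3 * y x ^ 4 - 2 * sqrt 3 * b * (y x)\<^sup>2" for x
  (* The modulus of the limiting saddle integral, so that the normalised integral Q tends to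
     a number of modulus 1. *)
  define N where "N = sqrt (pi / 6) * exp (b\<^sup>2 / 6) / 2"
  define Q where "Q x = (LINT s|lborel. saddle_integrand b (y x) s) / of_real N" for x
  (* Since Q tends to cis (- pi / 6), the main term is cos (\<theta> - pi / 6) and r is the error left over. *)
  define r where "r x = Re (cis (\<theta> x) * (Q x - cis (- (pi / 6))))" for x
  have N: "N > 0" by (simp add: N_def)

  have r_lim: "(r \<longlongrightarrow> 0) at_top"
  proof -
    have "filterlim y at_top at_top"
      unfolding y_def using \<sigma> by real_asymp
    from filterlim_compose[OF saddle_integral_tendsto[OF b] this]
    have "(Q \<longlongrightarrow> of_real (sqrt (pi / 6) * exp (b\<^sup>2 / 6)) / saddle_dir / of_real N) at_top"
      unfolding Q_def using N by (intro tendsto_divide tendsto_const) auto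
    also have "of_real (sqrt (pi / 6) * exp (b\<^sup>2 / 6)) = (2 * of_real N :: complex)"
      by (simp add: N_def)
    also have "2 * of_real N / saddle_dir / of_real N = 2 / saddle_dir"
      using N by simp
    also have "\<dots> = cis (- (pi / 6))"
      by (simp add: saddle_dir_def complex_eq_iff cos_30 sin_30 Re_divide Im_divide power2_eq_square)
    finally have "((\<lambda>x. norm (Q x - cis (- (pi / 6)))) \<longlongrightarrow> 0) at_top"
      by (intro tendsto_norm_zero LIM_zero)
    moreover have "norm (r x) \<le> norm (Q x - cis (- (pi / 6)))" for x
      using abs_Re_le_cmod[of "cis (\<theta> x) * (Q x - cis (- (pi / 6)))"] by (simp add: r_def norm_mult)
    then have "eventually (\<lambda>x. norm (r x) \<le> norm (Q x - cis (- (pi / 6)))) at_top"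
      by (rule always_eventually[OF allI])
    ultimately show ?thesis
      by (rule Lim_null_comparison[rotated])
  qed

  have "quartic_I M X x = complex_of_real
       (4 powr (1/3) / (sqrt 3 * \<sigma> powr (1/3) * x powr (1/3))
        * exp (quartic_Psi \<sigma> x) * (cos (quartic_Phi \<sigma> x) + r x))" if x: "x > 0" for x
  proof -
    have y: "y x > 0" using x \<sigma> by (simp add: y_def)
    note height = quartic_saddle_height_powers[OF x \<sigma>, folded y_def]
    have y2: "2 * b * (y x)\<^sup>2 = 1 / (4 powr (5/3) * \<sigma> powr (10/3)) * x powr (2/3)"
      using height(3) by (simp add: b_def)
    have Psi: "quartic_Psi \<sigma> x = x\<^sup>2 / (2 * \<sigma>\<^sup>2) + (- 24 * y x ^ 4 - 2 * b * (y x)\<^sup>2) + b\<^sup>2 / 6"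
      using \<sigma> unfolding quartic_Psi_def height(2)[symmetric] y2[symmetric]
      by (simp add: b_def power2_eq_square power4_eq_xxxx)
    have Phi: "quartic_Phi \<sigma> x = - (\<theta> x - pi / 6)"
      using arg_cong[OF height(2), of "\<lambda>t. sqrt 3 * t"] arg_cong[OF y2, of "\<lambda>t. sqrt 3 * t"]
      unfolding quartic_Phi_def \<theta>_def by (simp add: algebra_simps)
    have pref: "2 * (sqrt (pi / 6) / 2) / y x / sqrt (2 * pi * \<sigma>\<^sup>2)
        = 4 powr (1/3) / (sqrt 3 * \<sigma> powr (1/3) * x powr (1/3))"
    proof -
      have "2 * (sqrt (pi / 6) / 2) / y x / sqrt (2 * pi * \<sigma>\<^sup>2) = (sqrt (pi / 6) / sqrt (2 * pi * \<sigma>\<^sup>2)) / y x"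
        by simp
      also have "\<dots> = 1 / (2 * \<sigma> * y x) / sqrt 3"
        unfolding gaussian_prefactor[OF \<sigma>] by simp
      also have "\<dots> = 4 powr (1/3) / (sqrt 3 * \<sigma> powr (1/3) * x powr (1/3))"
        unfolding height(4) by simp
      finally show ?thesis .
    qed
    have half: "(LINT s|lborel. indicator {0<..} s *\<^sub>R quartic_weight b (x / \<sigma>\<^sup>2) (\<i> * of_real (y x) + of_real s))
      = of_real (exp (- 24 * y x ^ 4 - 2 * b * (y x)\<^sup>2) / y x * N) * (cis (\<theta> x) * Q x)"
      using half_line_integral_eq[OF y, of b] N unfolding height(1) by (simp add: \<theta>_def Q_def)
    have ReQ: "Re (cis (\<theta> x) * Q x) = cos (quartic_Phi \<sigma> x) + r x"
    proof -
      have "cis (\<theta> x) * Q x = cis (\<theta> x - pi / 6) + cis (\<theta> x) * (Q x - cis (- (pi / 6)))"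
        by (simp add: algebra_simps cis_mult)
      then show ?thesis unfolding Phi r_def cos_minus by simp
    qed
    have Re_mult: "Re (of_real a * z) = a * Re z" for a z
      by simp
    have shift: "(LINT t|lborel. quartic_weight b (x / \<sigma>\<^sup>2) (\<i> * of_real x + of_real t))
        = (LINT t|lborel. quartic_weight b (x / \<sigma>\<^sup>2) (\<i> * of_real (y x) + of_real t))"
      using b by (intro quartic_weight_shift) simp
    have "quartic_I M X x = of_real (exp (x\<^sup>2 / (2 * \<sigma>\<^sup>2)) / sqrt (2 * pi * \<sigma>\<^sup>2)) *
        of_real (2 * Re (LINT s|lborel. indicator {0<..} s *\<^sub>R
          quartic_weight b (x / \<sigma>\<^sup>2) (\<i> * of_real (y x) + of_real s)))"
      unfolding quartic_I_eq_line_integral[OF assms] b_def[symmetric] shift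
      by (subst quartic_weight_fold[OF less_imp_le[OF b]]) (rule refl)
    also have "\<dots> = of_real (exp (x\<^sup>2 / (2 * \<sigma>\<^sup>2)) / sqrt (2 * pi * \<sigma>\<^sup>2) *
        (2 * (exp (- 24 * y x ^ 4 - 2 * b * (y x)\<^sup>2) / y x * N * (cos (quartic_Phi \<sigma> x) + r x))))"
      unfolding half Re_mult ReQ by (rule of_real_mult[symmetric])
    also have "exp (x\<^sup>2 / (2 * \<sigma>\<^sup>2)) / sqrt (2 * pi * \<sigma>\<^sup>2) *
        (2 * (exp (- 24 * y x ^ 4 - 2 * b * (y x)\<^sup>2) / y x * N * (cos (quartic_Phi \<sigma> x) + r x)))
      = (2 * (sqrt (pi / 6) / 2) / y x / sqrt (2 * pi * \<sigma>\<^sup>2)) * exp (quartic_Psi \<sigma> x)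
         * (cos (quartic_Phi \<sigma> x) + r x)"
    proof -
      have "E / S * (2 * (F / Y * (K * B / 2) * C)) = (2 * (K / 2) / Y / S) * (E * F * B) * C"
        for E S F Y K B C :: real
        by (simp add: field_simps)
      then show ?thesis unfolding Psi exp_add N_def .
    qed
    finally show ?thesis unfolding pref .
  qed
  moreover have "r \<in> o[at_top](\<lambda>_. 1)"
    by (rule smalloI_tendsto) (simp_all add: r_lim)
  ultimately show ?thesis
    by (intro exI[of _ r] conjI allI impI)
qed

end
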